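(* Let $\Sigma=\{\mathtt{a},\mathtt{b}\}$, with the letters identified with fixed positive real numbers, let $s>0$, and let $M_s(w)=\prod_{k=1}^{|w|}(s+w_k)^{-1}$ for $w=w_1\cdots w_{|w|}\in\Sigma^*$. Let $N_0(\varepsilon)=\lfloor\log_2(1/\varepsilon)\rfloor$, let $$w_\varepsilon=\begin{cases}(\mathtt{a}\mathtt{b})^{\lfloor\varepsilon^{-1}\rfloor}&\text{if }\lfloor\log_2(1/\varepsilon)\rfloor\text{ is even},\\(\mathtt{b}\mathtt{a})^{\lfloor\varepsilon^{-1}\rfloor}&\text{if }\lfloor\log_2(1/\varepsilon)\rfloor\text{ is odd},\end{cases}$$ let $\mathbf{w}=[(w_\varepsilon)]\in\widetilde{\Sigma}^*$ and $z_\varepsilon:=M_s(w_\varepsilon[1\ldots N_0(\varepsilon)])$. Then the net $(z_\varepsilon)_{\varepsilon\in(0,1]}$, as a generalized number, depends only on the class $\mathbf{w}$ and not on the particular representative: for every representative $(u_\varepsilon)$ of $\mathbf{w}$, the net $(M_s(u_\varepsilon[1\ldots N_0(\varepsilon)]))_\varepsilon$ lies in $\mathcal{E}_M(\mathbb{C})$ and has the same class in $\widetilde{\mathbb{C}}$ as $(z_\varepsilon)$. Hence $\widetilde{M}_s(\mathbf{w}):=[(z_\varepsilon)]\in\widetilde{\mathbb{C}}$ is a well-defined generalized complex number.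
   Context: $\Sigma^*$ is the free monoid of finite words over $\Sigma$ under concatenation, $|w|$ is the length of $w$. For $n\in\mathbb{N}$, $w[1\ldots n]$ is the prefix of $w$ of length $n$, with $w[1\ldots n]:=w$ if $n>|w|$. For $u\neq v$ in $\Sigma^*$, $\operatorname{lcp}(u,v)$ and $\operatorname{lcs}(u,v)$ are the lengths of the longest common prefix and of the longest common suffix of $u,v$; by convention $\operatorname{lcp}(u,u)=\operatorname{lcs}(u,u)=+\infty$. A net of words is a family $(w_\varepsilon)_{\varepsilon\in(0,1]}$ of words in $\Sigma^*$. It is moderate if there exist $N\in\mathbb{N}$, $C>0$, $\varepsilon_0>0$ with $|w_\varepsilon|\le C\varepsilon^{-N}$ for all $\varepsilon<\varepsilon_0$. $\mathcal{E}_M(\Sigma^* )$ is the set of moderate nets. Two moderate nets are equivalent, $(u_\varepsilon)\sim(v_\varepsilon)$, if for every $m\in\mathbb{N}$ there exists $\varepsilon_0>0$ such that $\min\{\operatorname{lcp}(u_\varepsilon,v_\varepsilon),\operatorname{lcs}(u_\varepsilon,v_\varepsilon)\}\ge m\log_2(1/\varepsilon)$ for all $\varepsilon<\varepsilon_0$; this is an equivalence relation. $\widetilde{\Sigma}^*:=\mathcal{E}_M(\Sigma^* )/\sim$, with classes written $[(w_\varepsilon)]$. Generalized complex numbers: $\mathcal{E}_M(\mathbb{C})$ is the set of families $(z_\varepsilon)_{\varepsilon\in(0,1]}$ in $\mathbb{C}$ for which there are $N,C>0$ with $|z_\varepsilon|\le C\varepsilon^{-N}$ for all sufficiently small $\varepsilon$;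 $\mathcal{N}(\mathbb{C})$ is the set of families such that for every $m$ there is $C_m>0$ with $|z_\varepsilon|\le C_m\varepsilon^m$ for all sufficiently small $\varepsilon$; $\widetilde{\mathbb{C}}:=\mathcal{E}_M(\mathbb{C})/\mathcal{N}(\mathbb{C})$. *)

theory Defs
  imports "HOL-Analysis.Analysis" "HOL-Library.Sublist" "HOL-Library.Extended_Real"
begin

section \<open>Generalized words\<close>

text \<open>Words over \<open>\<Sigma>\<close> are lists over a type of letters.
  Nets are extensional functions on \<open>(0,1]\<close>, so that equality of nets is equality on \<open>(0,1]\<close>.\<close>

definition nets :: "(real \<Rightarrow> 'b) set" where
  "nets = {0<..1} \<rightarrow>\<^sub>E UNIV"

definition lcp :: "'a list \<Rightarrow> 'a list \<Rightarrow> enat" where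
  "lcp u v = (if u = v then \<infinity> else enat (length (longest_common_prefix u v)))"

definition lcs :: "'a list \<Rightarrow> 'a list \<Rightarrow> enat" where
  "lcs u v = (if u = v then \<infinity> else enat (Max {length p |p. suffix p u \<and> suffix p v}))"

definition moderate_words :: "(real \<Rightarrow> 'a list) set" where
  "moderate_words = {w \<in> nets. \<exists>N::nat. \<exists>C>0. \<exists>\<epsilon>0>0. \<forall>\<epsilon>\<in>{0<..1}. \<epsilon> < \<epsilon>0 \<longrightarrow>
     real (length (w \<epsilon>)) \<le> C * \<epsilon> powi (- int N)}"

definition word_rel :: "((real \<Rightarrow> 'a list) \<times> (real \<Rightarrow> 'a list)) set" where
  "word_rel = {(u, v). u \<in> moderate_words \<and> v \<in> moderate_words \<and>
     (\<forall>m::nat. \<exists>\<epsilon>0>0. \<forall>\<epsilon>\<in>{0<..1}. \<epsilon> < \<epsilon>0 \<longrightarrow>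
        ereal_of_enat (min (lcp (u \<epsilon>) (v \<epsilon>)) (lcs (u \<epsilon>) (v \<epsilon>))) \<ge> ereal (real m * log 2 (1 / \<epsilon>)))}"

definition gen_words :: "(real \<Rightarrow> 'a list) set set" where
  "gen_words = moderate_words // word_rel"

definition word_class :: "(real \<Rightarrow> 'a list) \<Rightarrow> (real \<Rightarrow> 'a list) set" where
  "word_class w = word_rel `` {w}"

section \<open>Generalized complex numbers\<close>

definition moderate_complex :: "(real \<Rightarrow> complex) set" where
  "moderate_complex = {z \<in> nets. \<exists>N>0. \<exists>C>0. \<forall>\<^sub>F \<epsilon> in at_right 0.
     cmod (z \<epsilon>) \<le> C * \<epsilon> powr (- N)}"

definition negligible_complex :: "(real \<Rightarrow> complex) set" where
  "negligible_complex = {z \<in> nets. \<forall>m::nat. \<exists>C>0. \<forall>\<^sub>F \<epsilon> in at_right 0.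
     cmod (z \<epsilon>) \<le> C * \<epsilon> ^ m}"

definition complex_rel :: "((real \<Rightarrow> complex) \<times> (real \<Rightarrow> complex)) set" where
  "complex_rel = {(y, z). y \<in> moderate_complex \<and> z \<in> moderate_complex \<and>
     (\<lambda>\<epsilon>\<in>{0<..1}. y \<epsilon> - z \<epsilon>) \<in> negligible_complex}"

definition gen_complex :: "(real \<Rightarrow> complex) set set" where
  "gen_complex = moderate_complex // complex_rel"

definition complex_class :: "(real \<Rightarrow> complex) \<Rightarrow> (real \<Rightarrow> complex) set" where
  "complex_class z = complex_rel `` {z}"

section \<open>The transform\<close>

datatype letter = A | B

text \<open>The identification of letters with real numbers is the valuation \<open>val\<close>.\<close>

definition M :: "('a \<Rightarrow> real) \<Rightarrow> real \<Rightarrow> 'a list \<Rightarrow> real" where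
  "M val s w = (\<Prod>k<length w. inverse (s + val (w ! k)))"

definition N0 :: "real \<Rightarrow> nat" where
  "N0 \<epsilon> = nat \<lfloor>log 2 (1 / \<epsilon>)\<rfloor>"

definition M_net :: "('a \<Rightarrow> real) \<Rightarrow> real \<Rightarrow> (real \<Rightarrow> 'a list) \<Rightarrow> real \<Rightarrow> complex" where
  "M_net val s u = (\<lambda>\<epsilon>\<in>{0<..1}. complex_of_real (M val s (take (N0 \<epsilon>) (u \<epsilon>))))"

definition w_net :: "real \<Rightarrow> letter list" where
  "w_net = (\<lambda>\<epsilon>\<in>{0<..1}.
     if even \<lfloor>log 2 (1 / \<epsilon>)\<rfloor>
     then concat (replicate (nat \<lfloor>inverse \<epsilon>\<rfloor>) [A, B])
     else concat (replicate (nat \<lfloor>inverse \<epsilon>\<rfloor>) [B, A]))"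

text \<open>The value at a class \<open>W\<close> is the common class of \<open>M_net val s u\<close> for all
  representatives \<open>u\<close> of \<open>W\<close>; it is meaningful only where this common class
  exists and is unique.\<close>

definition M_tilde :: "('a \<Rightarrow> real) \<Rightarrow> real \<Rightarrow> (real \<Rightarrow> 'a list) set \<Rightarrow> (real \<Rightarrow> complex) set" where
  "M_tilde val s W = (THE c. c \<in> gen_complex \<and> (\<forall>u\<in>W. complex_class (M_net val s u) = c))"

end

theory Submission
  imports Defs
begin

text \<open>
  Equivalence of word nets with \<open>m = 1\<close> already says that, for all small \<open>\<epsilon>\<close>, the common prefix
  of \<open>u \<epsilon>\<close> and \<open>v \<epsilon>\<close> has length at least \<open>log\<^sub>2 (1 / \<epsilon>)\<close>, hence at least \<open>N0 \<epsilon>\<close>. The truncations to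
  length \<open>N0 \<epsilon>\<close> therefore coincide exactly (\<open>word_rel_imp_eventually_same_prefix\<close>), and the two
  transformed nets agree near \<open>0\<close>. Nets agreeing near \<open>0\<close> have the same class, since every estimate
  that defines the class only concerns small \<open>\<epsilon>\<close> (\<open>complex_class_cong_eventually\<close>).

  Moderateness comes from the logarithmic truncation length: each factor \<open>inverse (s + val x)\<close> is
  bounded by a constant \<open>K \<ge> 1\<close> and there are at most \<open>log\<^sub>2 (1 / \<epsilon>)\<close> factors, so the product is at most
  \<open>K powr log\<^sub>2 (1 / \<epsilon>) = \<epsilon> powr (- log\<^sub>2 K)\<close> (\<open>M_net_moderate\<close>).
\<close>

lemma word_class_self:
  assumes "w \<in> moderate_words"
  shows "w \<in> word_class w"
  using assms by (auto simp: word_class_def word_rel_def lcp_def lcs_def intro: exI[of _ 1])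

lemma w_net_moderate: "w_net \<in> moderate_words"
proof -
  have len: "length (concat (replicate n [x, y])) = 2 * n" for n and x y :: letter
    by (induction n) auto
  have "real (length (w_net \<epsilon>)) \<le> 2 * \<epsilon> powi (- int 1)" if "\<epsilon> \<in> {0<..1}" for \<epsilon>
  proof -
    have "real (length (w_net \<epsilon>)) = 2 * of_int \<lfloor>inverse \<epsilon>\<rfloor>"
      using that by (auto simp: w_net_def len)
    also have "\<dots> \<le> 2 * inverse \<epsilon>"
      by linarith
    finally show ?thesis
      by (simp add: power_int_minus)
  qed
  then have "\<exists>N::nat. \<exists>C>0. \<exists>\<epsilon>0>0. \<forall>\<epsilon>\<in>{0<..1}. \<epsilon> < \<epsilon>0 \<longrightarrow>
     real (length (w_net \<epsilon>)) \<le> C * \<epsilon> powi (- int N)"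
    by (intro exI[of _ 1] exI[of _ 2] conjI) (auto intro: exI[of _ 1])
  then show ?thesis
    by (auto simp: moderate_words_def nets_def w_net_def)
qed

lemma take_eq_if_le_lcp:
  assumes "enat n \<le> lcp u v"
  shows "take n u = take n v"
proof (cases "u = v")
  case False
  define p where "p = longest_common_prefix u v"
  have "n \<le> length p"
    using assms False by (simp add: lcp_def p_def)
  moreover have "prefix p u" "prefix p v"
    unfolding p_def by (rule longest_common_prefix_prefix1 longest_common_prefix_prefix2)+
  ultimately show ?thesis
    by (auto simp: prefix_def)
qed simp

lemma real_N0:
  assumes "0 < \<epsilon>" "\<epsilon> \<le> 1"
  shows "real (N0 \<epsilon>) \<le> log 2 (1 / \<epsilon>)"
proof -
  have "0 \<le> log 2 (1 / \<epsilon>)"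
    using assms by simp
  then show ?thesis
    unfolding N0_def by simp
qed

lemma word_rel_imp_eventually_same_prefix:
  assumes "(u, v) \<in> word_rel"
  shows "\<forall>\<^sub>F \<epsilon> in at_right 0. take (N0 \<epsilon>) (u \<epsilon>) = take (N0 \<epsilon>) (v \<epsilon>)"
proof -
  obtain \<epsilon>0 :: real where "\<epsilon>0 > 0" and le: "\<And>\<epsilon>. \<epsilon> \<in> {0<..1} \<Longrightarrow> \<epsilon> < \<epsilon>0 \<Longrightarrow>
      ereal (real 1 * log 2 (1 / \<epsilon>)) \<le> ereal_of_enat (min (lcp (u \<epsilon>) (v \<epsilon>)) (lcs (u \<epsilon>) (v \<epsilon>)))"
    using assms unfolding word_rel_def by blast
  have "take (N0 \<epsilon>) (u \<epsilon>) = take (N0 \<epsilon>) (v \<epsilon>)" if "0 < \<epsilon>" "\<epsilon> < min \<epsilon>0 1" for \<epsilon>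
  proof (rule take_eq_if_le_lcp)
    have "ereal_of_enat (enat (N0 \<epsilon>)) \<le> ereal (real 1 * log 2 (1 / \<epsilon>))"
      using real_N0[of \<epsilon>] that by simp
    also have "\<dots> \<le> ereal_of_enat (min (lcp (u \<epsilon>) (v \<epsilon>)) (lcs (u \<epsilon>) (v \<epsilon>)))"
      using that by (intro le) auto
    finally show "enat (N0 \<epsilon>) \<le> lcp (u \<epsilon>) (v \<epsilon>)"
      by (simp only: ereal_of_enat_le_iff min.bounded_iff)
  qed
  then show ?thesis
    using \<open>\<epsilon>0 > 0\<close> unfolding eventually_at_right_field
    by (intro exI[of _ "min \<epsilon>0 1"]) auto
qed

lemma negligible_complex_cong_eventually:
  assumes "y \<in> nets" "z \<in> nets" "\<forall>\<^sub>F \<epsilon> in at_right 0. y \<epsilon> = z \<epsilon>" "y \<in> negligible_complex"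
  shows "z \<in> negligible_complex"
  unfolding negligible_complex_def
proof (intro CollectI conjI allI)
  fix m :: nat
  obtain C where "C > 0" "\<forall>\<^sub>F \<epsilon> in at_right 0. cmod (y \<epsilon>) \<le> C * \<epsilon> ^ m"
    using assms(4) unfolding negligible_complex_def by blast
  moreover from this(2) assms(3) have "\<forall>\<^sub>F \<epsilon> in at_right 0. cmod (z \<epsilon>) \<le> C * \<epsilon> ^ m"
    by eventually_elim simp
  ultimately show "\<exists>C>0. \<forall>\<^sub>F \<epsilon> in at_right 0. cmod (z \<epsilon>) \<le> C * \<epsilon> ^ m"
    by blast
qed (rule assms(2))

text \<open>The differences of \<open>y\<close> and of \<open>z\<close> with any third net agree near \<open>0\<close>, so one is negligible
  exactly if the other is.\<close>

lemma complex_class_cong_eventually: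
  assumes "y \<in> moderate_complex" "z \<in> moderate_complex"
    and "\<forall>\<^sub>F \<epsilon> in at_right 0. y \<epsilon> = z \<epsilon>"
  shows "complex_class y = complex_class z"
proof -
  have sub: "complex_class y \<subseteq> complex_class z"
    if "z \<in> moderate_complex" and eq: "\<forall>\<^sub>F \<epsilon> in at_right 0. y \<epsilon> = z \<epsilon>" for y z
  proof
    fix x assume "x \<in> complex_class y"
    then have x: "x \<in> moderate_complex" "(\<lambda>\<epsilon>\<in>{0<..1}. y \<epsilon> - x \<epsilon>) \<in> negligible_complex"
      by (auto simp: complex_class_def complex_rel_def)
    have "(\<lambda>\<epsilon>\<in>{0<..1}. z \<epsilon> - x \<epsilon>) \<in> negligible_complex"
    proof (rule negligible_complex_cong_eventually[OF _ _ _ x(2)])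
      show "\<forall>\<^sub>F \<epsilon> in at_right 0. (\<lambda>\<epsilon>\<in>{0<..1}. y \<epsilon> - x \<epsilon>) \<epsilon> = (\<lambda>\<epsilon>\<in>{0<..1}. z \<epsilon> - x \<epsilon>) \<epsilon>"
        using eq by eventually_elim (auto simp: restrict_def)
    qed (auto simp: nets_def)
    then show "x \<in> complex_class z"
      using that(1) x(1) by (auto simp: complex_class_def complex_rel_def)
  qed
  have "\<forall>\<^sub>F \<epsilon> in at_right 0. z \<epsilon> = y \<epsilon>"
    using assms(3) by eventually_elim simp
  then show ?thesis
    using sub assms by blast
qed

lemma abs_M_le_power:
  assumes "\<And>x. val x > 0" and "s > 0" and "inverse s \<le> K" and "1 \<le> K" and "length w \<le> n"
  shows "\<bar>M val s w\<bar> \<le> K ^ n"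
proof -
  have "\<bar>M val s w\<bar> = (\<Prod>k<length w. \<bar>inverse (s + val (w ! k))\<bar>)"
    by (simp add: M_def abs_prod)
  also have "\<dots> \<le> (\<Prod>k<length w. K)"
  proof (rule prod_mono)
    fix k
    have "inverse (s + val (w ! k)) \<le> inverse s"
      using assms(1)[of "w ! k"] assms(2) by (intro le_imp_inverse_le) auto
    also note \<open>inverse s \<le> K\<close>
    finally show "0 \<le> \<bar>inverse (s + val (w ! k))\<bar> \<and> \<bar>inverse (s + val (w ! k))\<bar> \<le> K"
      using assms(1)[of "w ! k"] assms(2) by simp
  qed
  also have "\<dots> \<le> K ^ n"
    using assms(4,5) by (simp add: power_increasing)
  finally show ?thesis .
qed

lemma M_net_moderate:
  assumes "\<And>x. val x > 0" and "s > 0"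
  shows "M_net val s u \<in> moderate_complex"
proof -
  \<comment> \<open>The lower bound \<open>2\<close>, rather than \<open>1\<close>, makes the exponent \<open>log 2 K\<close> strictly positive.\<close>
  define K where "K = max 2 (inverse s)"
  have "2 \<le> K"
    by (simp add: K_def)
  have bound: "cmod (M_net val s u \<epsilon>) \<le> 1 * \<epsilon> powr (- log 2 K)" if "0 < \<epsilon>" "\<epsilon> < 1" for \<epsilon>
  proof -
    have "cmod (M_net val s u \<epsilon>) = \<bar>M val s (take (N0 \<epsilon>) (u \<epsilon>))\<bar>"
      using that by (simp add: M_net_def)
    also have "\<dots> \<le> K ^ N0 \<epsilon>"
      using assms by (intro abs_M_le_power) (auto simp: K_def)
    also have "\<dots> = K powr real (N0 \<epsilon>)"
      using \<open>2 \<le> K\<close> by (simp add: powr_realpow)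
    also have "\<dots> \<le> K powr log 2 (1 / \<epsilon>)"
      using \<open>2 \<le> K\<close> real_N0[of \<epsilon>] that by (intro powr_mono) auto
    also have "\<dots> = \<epsilon> powr (- log 2 K)"
      using \<open>2 \<le> K\<close> that by (simp add: powr_def log_def ln_div)
    finally show ?thesis
      by simp
  qed
  have "\<forall>\<^sub>F \<epsilon> in at_right 0. cmod (M_net val s u \<epsilon>) \<le> 1 * \<epsilon> powr (- log 2 K)"
    unfolding eventually_at_right_field using bound by (intro exI[of _ 1]) auto
  moreover have "log 2 K > 0"
    using \<open>2 \<le> K\<close> by simp
  moreover have "M_net val s u \<in> nets"
    by (simp add: M_net_def nets_def)
  ultimately show ?thesis
    unfolding moderate_complex_def
    by (intro CollectI conjI exI[of _ "log 2 K"] exI[of _ "1 :: real"]) auto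
qed

lemma complex_class_M_net_cong:
  assumes "\<And>x. val x > 0" and "s > 0" and "(u, v) \<in> word_rel"
  shows "complex_class (M_net val s u) = complex_class (M_net val s v)"
proof (rule complex_class_cong_eventually)
  show "\<forall>\<^sub>F \<epsilon> in at_right 0. M_net val s u \<epsilon> = M_net val s v \<epsilon>"
    using word_rel_imp_eventually_same_prefix[OF assms(3)]
    by eventually_elim (simp add: M_net_def restrict_def)
qed (use assms(1,2) in \<open>auto intro: M_net_moderate\<close>)

theorem theorem4p1:
  fixes val :: "letter \<Rightarrow> real" and s :: real
  assumes "\<And>x. val x > 0" and "s > 0"
  shows "word_class w_net \<in> gen_words
    \<and> (\<forall>u \<in> word_class w_net.
         M_net val s u \<in> moderate_complex
         \<and> complex_class (M_net val s u) = complex_class (M_net val s w_net))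
    \<and> complex_class (M_net val s w_net) \<in> gen_complex
    \<and> (\<exists>!c. c \<in> gen_complex \<and> (\<forall>u \<in> word_class w_net. complex_class (M_net val s u) = c))
    \<and> M_tilde val s (word_class w_net) = complex_class (M_net val s w_net)"
proof -
  let ?c = "complex_class (M_net val s w_net)"
  have words: "word_class w_net \<in> gen_words"
    unfolding gen_words_def word_class_def by (rule quotientI[OF w_net_moderate])
  have mod: "M_net val s u \<in> moderate_complex" for u
    by (rule M_net_moderate[OF assms])
  have same: "complex_class (M_net val s u) = ?c" if "u \<in> word_class w_net" for u
  proof -
    have "(w_net, u) \<in> word_rel"
      using that by (simp add: word_class_def)
    then show ?thesis
      by (rule complex_class_M_net_cong[OF assms, symmetric])
  qed
  have gen: "?c \<in> gen_complex"
    unfolding gen_complex_def complex_class_def by (rule quotientI[OF mod])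
  \<comment> \<open>Uniqueness needs a representative: an empty class would make every \<open>c\<close> admissible.\<close>
  have iff: "c \<in> gen_complex \<and> (\<forall>u \<in> word_class w_net. complex_class (M_net val s u) = c)
      \<longleftrightarrow> c = ?c" for c
    using same gen word_class_self[OF w_net_moderate] by metis
  have "M_tilde val s (word_class w_net) = ?c"
    unfolding M_tilde_def iff by simp
  moreover have "\<exists>!c. c \<in> gen_complex \<and> (\<forall>u \<in> word_class w_net. complex_class (M_net val s u) = c)"
    unfolding iff by simp
  ultimately show ?thesis
    using words mod same gen by simp
qed

end
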